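(* Let $V$ be an inner vertex of valence $N=\mathrm{val}(V)$ of the mesh, and suppose the "Eq(0)"-type equations hold at $V$ for all edges adjacent to $V$. Then: (1) The system of "Eq(1)"-type equations applied simultaneously to all edges adjacent to $V$ has the form $$M\begin{pmatrix}tw^{(1)}\\ \vdots\\ tw^{(N)}\end{pmatrix}=\begin{pmatrix}\mathrm{coeff}^{(1)}\delta^{(1)}\\ \vdots\\ \mathrm{coeff}^{(N)}\delta^{(N)}\end{pmatrix},$$ where $M$ is the $N\times N$ circulant matrix whose $j$-th row has entries $1$ in columns $j$ and $j-1$ (column indices modulo $N$) and $0$ elsewhere. (2) If $N$ is odd, $M$ is of full rank. If $N$ is even, $\mathrm{rank}(M)=N-1$ and the system (with unknowns $tw^{(1)},\dots,tw^{(N)}$) has a solution if and only if the "Circular Constraint" $$\sum_{j=1}^{N}(-1)^j\,\mathrm{coeff}^{(j)}\delta^{(j)}=0$$ is satisfied.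
   Context: Mesh: a planar domain is subdivided into strictly convex quadrilaterals (all interior angles less than $\pi$), any two being disjoint or sharing exactly a common vertex or a common edge. $\langle a,b\rangle=a_Xb_Y-a_Yb_X$ for planar vectors. Each element with consecutive vertices $A,B,C,D$ is parametrised bilinearly by $A(1-u)(1-v)+Bu(1-v)+Cuv+D(1-u)v$. Over each element a degree-$n$ ($n\ge4$) tensor-product B\'ezier polynomial gives the $Z$-coordinate; coefficients ($Z$-components of control points) of adjacent elements coincide along common edges. The resulting $3D$ patch has $XY$-part the bilinear map. At the inner vertex $V$: edges from $V$ go to vertices $V^{(1)},\dots,V^{(N)}$ ordered counter-clockwise, indices modulo $N$; $e^{(j)}=V^{(j)}-V$. The element between $e^{(j)}$ and $e^{(j+1)}$ carries the patch $\bar P^{(j)}(u,v)$ with $(0,0)\mapsto V$, $u$ running along $e^{(j)}$ and $v$ along $e^{(j+1)}$. Put $\bar\epsilon^{(j)}=\partial\bar P^{(j)}/\partial u(0,0)=\partial \bar P^{(j-1)}/\partial v(0,0)\in\mathbb R^3$, $\bar\tau^{(j)}=\partial^2\bar P^{(j)}/\partial u\partial v(0,0)\in\mathbb R^3$, and let $\delta^{(j)}$ be the $Z$-component of $\partial^2\bar P^{(j)}/\partial u^2(0,0)$. Define $$tw^{(j)}=\frac{\det(\bar\tau^{(j)},\bar\epsilon^{(j)},\bar\epsilon^{(j+1)})}{\langle e^{(j)},e^{(j+1)}\rangle^2},\qquad \mathrm{coeff}^{(j)}=\frac{\langle e^{(j-1)},e^{(j+1)}\rangle}{\langle e^{(j-1)},e^{(j)}\rangle\langle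 e^{(j)},e^{(j+1)}\rangle}.$$ "Eq(0)"- and "Eq(1)"-type equations at $V$ for an edge from $\gamma=V$ to $\gamma'$: let the element on the right of the directed edge have vertices $\gamma,\rho,\rho',\gamma'$ and the one on the left $\gamma,\lambda,\lambda',\gamma'$ (cyclic order). Put $l_0=\langle\rho-\gamma,\gamma'-\gamma\rangle$, $l_1=\langle\gamma-\gamma',\rho'-\gamma'\rangle$, $r_0=-\langle\gamma'-\gamma,\lambda-\gamma\rangle$, $r_1=-\langle\lambda'-\gamma',\gamma-\gamma'\rangle$, $c_0=\langle\rho-\gamma,\lambda-\gamma\rangle$, $c_1=\frac12[\langle\rho-\gamma,\lambda'-\gamma'\rangle-\langle\lambda-\gamma,\rho'-\gamma'\rangle]$. Let $C_j$ ($j=0,\dots,n$) be the $Z$-coefficients along the common edge ordered from $\gamma$ to $\gamma'$, and $L_j$, $R_j$ the $Z$-coefficients of the adjacent parallel rows in the left and right element; $\Delta L_j=C_j-L_j$, $\Delta R_j=R_j-C_j$, $\Delta C_j=C_{j+1}-C_j$. Then Eq(0): $l_0\Delta L_0+r_0\Delta R_0+c_0\Delta C_0=0$; Eq(1): $n(l_0\Delta L_1+r_0\Delta R_1)+(l_1\Delta L_0+r_1\Delta R_0)+(n-1)c_0\Delta C_1+2c_1\Delta C_0=0$. "Has the form" means that, given the Eq(0)-type equations, the system of Eq(1)-type equations is equivalent to the displayed one. *)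

theory Defs
  imports "HOL-Analysis.Analysis" "Jordan_Normal_Form.DL_Rank"
begin

(* Both HOL-Analysis and Jordan_Normal_Form use "$" for component access; here it is
   always the one of HOL-Analysis.  Jordan_Normal_Form only provides vectors and matrices
   whose size is the natural number N, together with their rank. *)
no_notation Matrix.vec_index (infixl "$" 100)

type_synonym point = "real^2"

definition cr :: "point \<Rightarrow> point \<Rightarrow> real" where
  "cr a b = a $ 1 * b $ 2 - a $ 2 * b $ 1"


subsection \<open>Quadrilateral meshes\<close>

text \<open>A, B, C, D are the consecutive vertices, in counter-clockwise order, of a quadrilateral
  all of whose interior angles are positive and less than \<open>\<pi>\<close>. (The boundary turns left by an
  angle strictly between 0 and \<open>\<pi>\<close> at each of the four corners, so that it winds around exactly
  once.)\<close>

definition strictly_convex_quad :: "point \<Rightarrow> point \<Rightarrow> point \<Rightarrow> point \<Rightarrow> bool" where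
  "strictly_convex_quad A B C D \<longleftrightarrow>
     cr (B - A) (C - B) > 0 \<and> cr (C - B) (D - C) > 0 \<and>
     cr (D - C) (A - D) > 0 \<and> cr (A - D) (B - A) > 0"

text \<open>A mesh is given by its set of elements, which are closed regions of the plane. An element
  occurs in the next predicate under four labellings, one for each choice of the first vertex.\<close>

definition quad_vertices :: "point set \<Rightarrow> point \<Rightarrow> point \<Rightarrow> point \<Rightarrow> point \<Rightarrow> bool" where
  "quad_vertices t A B C D \<longleftrightarrow> strictly_convex_quad A B C D \<and> t = convex hull {A, B, C, D}"

definition quad_vertex :: "point set \<Rightarrow> point \<Rightarrow> bool" where
  "quad_vertex t P \<longleftrightarrow> (\<exists>B C D. quad_vertices t P B C D)"

definition quad_edge :: "point set \<Rightarrow> point \<Rightarrow> point \<Rightarrow> bool" where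
  "quad_edge t P Q \<longleftrightarrow> (\<exists>C D. quad_vertices t P Q C D \<or> quad_vertices t Q P C D)"

definition quad_mesh :: "point set set \<Rightarrow> bool" where
  "quad_mesh T \<longleftrightarrow>
     finite T \<and>
     (\<forall>t\<in>T. \<exists>A B C D. quad_vertices t A B C D) \<and>
     (\<forall>s\<in>T. \<forall>t\<in>T. s \<noteq> t \<longrightarrow>
        s \<inter> t = {} \<or>
        (\<exists>P. quad_vertex s P \<and> quad_vertex t P \<and> s \<inter> t = {P}) \<or>
        (\<exists>P Q. quad_edge s P Q \<and> quad_edge t P Q \<and> s \<inter> t = closed_segment P Q))"

definition mesh_element :: "point set set \<Rightarrow> point \<Rightarrow> point \<Rightarrow> point \<Rightarrow> point \<Rightarrow> bool" where
  "mesh_element T A B C D \<longleftrightarrow> (\<exists>t\<in>T. quad_vertices t A B C D)"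

definition inner_vertex :: "point set set \<Rightarrow> point \<Rightarrow> bool" where
  "inner_vertex T V \<longleftrightarrow> (\<exists>t\<in>T. quad_vertex t V) \<and> V \<in> interior (\<Union>T)"

definition neighbours :: "point set set \<Rightarrow> point \<Rightarrow> point set" where
  "neighbours T V = {P. \<exists>t\<in>T. quad_edge t V P}"

definition valence :: "point set set \<Rightarrow> point \<Rightarrow> nat" where
  "valence T V = card (neighbours T V)"

text \<open>The edges at V end at \<open>vs 1, \<dots>, vs N\<close> in counter-clockwise order: each of them occurs once,
  and the element on the left of the edge to \<open>vs j\<close> has the edge to \<open>vs (j + 1)\<close> as its other
  edge at V. Its remaining vertex is \<open>W j\<close>. Indices are modulo N, that is, the families are
  periodic on the integers.\<close>

definition ccw_star ::
    "point set set \<Rightarrow> point \<Rightarrow> nat \<Rightarrow> (int \<Rightarrow> point) \<Rightarrow> (int \<Rightarrow> point) \<Rightarrow> bool" where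
  "ccw_star T V N vs W \<longleftrightarrow>
     bij_betw vs {1..int N} (neighbours T V) \<and>
     (\<forall>j. vs (j + int N) = vs j \<and> W (j + int N) = W j) \<and>
     (\<forall>j. mesh_element T V (vs j) (W j) (vs (j + 1)))"


subsection \<open>Tensor-product Bezier patches\<close>

text \<open>\<open>Z A B C D i k\<close> is the Z-coefficient with index i in the direction AB and k in the
  direction AD, of the polynomial over the element with consecutive vertices A, B, C, D. The four
  labellings of an element refer to one and the same polynomial: passing from A, B, C, D to
  B, C, D, A substitutes \<open>u = 1 - v'\<close> and \<open>v = u'\<close> in the bilinear parametrisation, which is the
  first condition of \<open>bezier_net\<close>. In the second one, AB is the common edge of the two
  elements.\<close>

type_synonym net = "point \<Rightarrow> point \<Rightarrow> point \<Rightarrow> point \<Rightarrow> nat \<Rightarrow> nat \<Rightarrow> real"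

definition bezier_net :: "point set set \<Rightarrow> nat \<Rightarrow> net \<Rightarrow> bool" where
  "bezier_net T n Z \<longleftrightarrow>
     (\<forall>A B C D. mesh_element T A B C D \<longrightarrow>
        (\<forall>i\<le>n. \<forall>k\<le>n. Z B C D A i k = Z A B C D (n - k) i)) \<and>
     (\<forall>A B C D E F. mesh_element T A B C D \<and> mesh_element T A E F B \<longrightarrow>
        (\<forall>k\<le>n. Z A B C D k 0 = Z A E F B 0 k))"

definition bilinear_map ::
    "point \<Rightarrow> point \<Rightarrow> point \<Rightarrow> point \<Rightarrow> real \<Rightarrow> real \<Rightarrow> point" where
  "bilinear_map A B C D u v =
     ((1 - u) * (1 - v)) *\<^sub>R A + (u * (1 - v)) *\<^sub>R B + (u * v) *\<^sub>R C + ((1 - u) * v) *\<^sub>R D"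

definition bezier_poly :: "nat \<Rightarrow> (nat \<Rightarrow> nat \<Rightarrow> real) \<Rightarrow> real \<Rightarrow> real \<Rightarrow> real" where
  "bezier_poly n c u v = (\<Sum>i\<le>n. \<Sum>k\<le>n. c i k * Bernstein n i u * Bernstein n k v)"

definition patch ::
    "nat \<Rightarrow> net \<Rightarrow> point \<Rightarrow> point \<Rightarrow> point \<Rightarrow> point \<Rightarrow> real \<Rightarrow> real \<Rightarrow> real^3" where
  "patch n Z A B C D u v =
     vector [bilinear_map A B C D u v $ 1, bilinear_map A B C D u v $ 2,
             bezier_poly n (Z A B C D) u v]"


subsection \<open>The quantities at an inner vertex\<close>

definition star_patch ::
    "nat \<Rightarrow> net \<Rightarrow> point \<Rightarrow> (int \<Rightarrow> point) \<Rightarrow> (int \<Rightarrow> point) \<Rightarrow> int \<Rightarrow> real \<Rightarrow> real \<Rightarrow> real^3" where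
  "star_patch n Z V vs W j = patch n Z V (vs j) (W j) (vs (j + 1))"

definition eps ::
    "nat \<Rightarrow> net \<Rightarrow> point \<Rightarrow> (int \<Rightarrow> point) \<Rightarrow> (int \<Rightarrow> point) \<Rightarrow> int \<Rightarrow> real^3" where
  "eps n Z V vs W j = vector_derivative (\<lambda>u. star_patch n Z V vs W j u 0) (at 0)"

definition tau ::
    "nat \<Rightarrow> net \<Rightarrow> point \<Rightarrow> (int \<Rightarrow> point) \<Rightarrow> (int \<Rightarrow> point) \<Rightarrow> int \<Rightarrow> real^3" where
  "tau n Z V vs W j =
     vector_derivative (\<lambda>u. vector_derivative (\<lambda>v. star_patch n Z V vs W j u v) (at 0)) (at 0)"

definition delta ::
    "nat \<Rightarrow> net \<Rightarrow> point \<Rightarrow> (int \<Rightarrow> point) \<Rightarrow> (int \<Rightarrow> point) \<Rightarrow> int \<Rightarrow> real" where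
  "delta n Z V vs W j =
     vector_derivative (\<lambda>u. vector_derivative (\<lambda>w. star_patch n Z V vs W j w 0) (at u)) (at 0) $ 3"

definition tw ::
    "nat \<Rightarrow> net \<Rightarrow> point \<Rightarrow> (int \<Rightarrow> point) \<Rightarrow> (int \<Rightarrow> point) \<Rightarrow> int \<Rightarrow> real" where
  "tw n Z V vs W j =
     Determinants.det
       (vector [tau n Z V vs W j, eps n Z V vs W j, eps n Z V vs W (j + 1)] :: real^3^3)
     / (cr (vs j - V) (vs (j + 1) - V))\<^sup>2"

definition edge_coeff :: "point \<Rightarrow> (int \<Rightarrow> point) \<Rightarrow> int \<Rightarrow> real" where
  "edge_coeff V vs j =
     cr (vs (j - 1) - V) (vs (j + 1) - V) /
     (cr (vs (j - 1) - V) (vs j - V) * cr (vs j - V) (vs (j + 1) - V))"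


subsection \<open>The equations along an edge\<close>

text \<open>In \<open>eq_zero\<close> and \<open>eq_one\<close> the directed edge goes from g to g', the element on its right has
  the vertices g, r, r', g' and the one on its left g, l, l', g', in cyclic order. The latter is
  counter-clockwise when listed as g, g', l', l.\<close>

definition row_C :: "net \<Rightarrow> point \<Rightarrow> point \<Rightarrow> point \<Rightarrow> point \<Rightarrow> nat \<Rightarrow> real" where
  "row_C Z g g' l l' k = Z g g' l' l k 0"

definition row_L :: "net \<Rightarrow> point \<Rightarrow> point \<Rightarrow> point \<Rightarrow> point \<Rightarrow> nat \<Rightarrow> real" where
  "row_L Z g g' l l' k = Z g g' l' l k 1"

definition row_R :: "net \<Rightarrow> point \<Rightarrow> point \<Rightarrow> point \<Rightarrow> point \<Rightarrow> nat \<Rightarrow> real" where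
  "row_R Z g g' r r' k = Z g r r' g' 1 k"

definition eq_zero ::
    "net \<Rightarrow> point \<Rightarrow> point \<Rightarrow> point \<Rightarrow> point \<Rightarrow> point \<Rightarrow> point \<Rightarrow> bool" where
  "eq_zero Z g g' r r' l l' \<longleftrightarrow>
    (let C = row_C Z g g' l l'; L = row_L Z g g' l l'; R = row_R Z g g' r r';
         dL = (\<lambda>k. C k - L k); dR = (\<lambda>k. R k - C k); dC = (\<lambda>k. C (k + 1) - C k);
         l0 = cr (r - g) (g' - g);
         r0 = - cr (g' - g) (l - g);
         c0 = cr (r - g) (l - g)
     in l0 * dL 0 + r0 * dR 0 + c0 * dC 0 = 0)"

definition eq_one ::
    "nat \<Rightarrow> net \<Rightarrow> point \<Rightarrow> point \<Rightarrow> point \<Rightarrow> point \<Rightarrow> point \<Rightarrow> point \<Rightarrow> bool" where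
  "eq_one n Z g g' r r' l l' \<longleftrightarrow>
    (let C = row_C Z g g' l l'; L = row_L Z g g' l l'; R = row_R Z g g' r r';
         dL = (\<lambda>k. C k - L k); dR = (\<lambda>k. R k - C k); dC = (\<lambda>k. C (k + 1) - C k);
         l0 = cr (r - g) (g' - g);
         l1 = cr (g - g') (r' - g');
         r0 = - cr (g' - g) (l - g);
         r1 = - cr (l' - g') (g - g');
         c0 = cr (r - g) (l - g);
         c1 = (cr (r - g) (l' - g') - cr (l - g) (r' - g')) / 2
     in real n * (l0 * dL 1 + r0 * dR 1) + (l1 * dL 0 + r1 * dR 0)
        + (real n - 1) * c0 * dC 1 + 2 * c1 * dC 0 = 0)"

text \<open>The equations at V for the edge to \<open>vs j\<close>.\<close>

definition eq_zero_at ::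
    "net \<Rightarrow> point \<Rightarrow> (int \<Rightarrow> point) \<Rightarrow> (int \<Rightarrow> point) \<Rightarrow> int \<Rightarrow> bool" where
  "eq_zero_at Z V vs W j \<longleftrightarrow>
     eq_zero Z V (vs j) (vs (j - 1)) (W (j - 1)) (vs (j + 1)) (W j)"

definition eq_one_at ::
    "nat \<Rightarrow> net \<Rightarrow> point \<Rightarrow> (int \<Rightarrow> point) \<Rightarrow> (int \<Rightarrow> point) \<Rightarrow> int \<Rightarrow> bool" where
  "eq_one_at n Z V vs W j \<longleftrightarrow>
     eq_one n Z V (vs j) (vs (j - 1)) (W (j - 1)) (vs (j + 1)) (W j)"


subsection \<open>The linear system\<close>

text \<open>Matrix and vector positions are counted from 0, so position i belongs to the index
  \<open>i + 1\<close> of the families above.\<close>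

definition circ_matrix :: "nat \<Rightarrow> real mat" where
  "circ_matrix N =
     Matrix.mat N N (\<lambda>(i, k). if k = i \<or> k = (i + N - 1) mod N then 1 else 0)"

definition tw_vec ::
    "nat \<Rightarrow> nat \<Rightarrow> net \<Rightarrow> point \<Rightarrow> (int \<Rightarrow> point) \<Rightarrow> (int \<Rightarrow> point) \<Rightarrow> real Matrix.vec" where
  "tw_vec N n Z V vs W = Matrix.vec N (\<lambda>i. tw n Z V vs W (int i + 1))"

definition rhs_vec ::
    "nat \<Rightarrow> nat \<Rightarrow> net \<Rightarrow> point \<Rightarrow> (int \<Rightarrow> point) \<Rightarrow> (int \<Rightarrow> point) \<Rightarrow> real Matrix.vec" where
  "rhs_vec N n Z V vs W =
     Matrix.vec N (\<lambda>i. edge_coeff V vs (int i + 1) * delta n Z V vs W (int i + 1))"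

definition circular_constraint ::
    "nat \<Rightarrow> nat \<Rightarrow> net \<Rightarrow> point \<Rightarrow> (int \<Rightarrow> point) \<Rightarrow> (int \<Rightarrow> point) \<Rightarrow> bool" where
  "circular_constraint N n Z V vs W \<longleftrightarrow>
     (\<Sum>j = 1..N. (-1) ^ j * (edge_coeff V vs (int j) * delta n Z V vs W (int j))) = 0"

end

theory Submission
  imports Defs
begin

text \<open>
  Fix the edge from \<open>V\<close> to \<open>vs j\<close>. In the element \<open>j\<close> on its left and in the element \<open>j - 1\<close> on its
  right, the first derivatives, the mixed second derivative and the second derivative along the
  edge at the corner \<open>V\<close> are finite differences of the net near that corner. Rewritten in these
  quantities, Eq(0) says that the three tangents \<open>eps (j - 1)\<close>, \<open>eps j\<close>, \<open>eps (j + 1)\<close> lie in one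
  plane, and \<open>n\<close> times the left side of Eq(1) is a linear expression in the mixed derivatives, in
  \<open>delta j\<close> and in the heights of the tangents, plus a multiple of Eq(0).

  The numerators of \<open>tw j\<close> and \<open>tw (j - 1)\<close> each contain the height of only two of the three
  tangents. Coplanarity trades one height for the others, and the Pluecker relation between
  the cross products of four planar vectors collects what remains. The result
  (\<open>eq_one_at_iff_twist\<close>) is that, given Eq(0), Eq(1) is the equation
  \<open>tw j + tw (j - 1) = edge_coeff j * delta j\<close> up to the factor
  \<open>- cr (e (j - 1)) (e j) * cr (e j) (e (j + 1))\<close>, where \<open>e i\<close> is \<open>vs i - V\<close>. This factor is
  nonzero because the elements are strictly convex. Running over all edges gives the circulant
  system.

  For the circulant matrix, a vector in the kernel alternates in sign from each entry to the next.
  Closing the cycle is impossible for odd \<open>N\<close> unless the vector is zero, and is automatic for even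
  \<open>N\<close>. The rank drops by at most one since cancelling the single corner entry leaves a unit lower
  triangular matrix. For even \<open>N\<close> the alternating sum of the equations eliminates all unknowns,
  and this necessary condition suffices, since the equations other than the first one can always
  be solved by forward substitution and the first then reduces to that condition.
\<close>

section \<open>Derivatives of Bezier curves and of the patches\<close>

definition bezier_curve :: "nat \<Rightarrow> (nat \<Rightarrow> real) \<Rightarrow> real \<Rightarrow> real" where
  "bezier_curve m c x = (\<Sum>i\<le>m. c i * Bernstein m i x)"

lemma Bernstein_Suc_0: "Bernstein (Suc m) 0 x = (1 - x) * Bernstein m 0 x"
  by (simp add: Bernstein_def)

lemma Bernstein_Suc_Suc:
  "Bernstein (Suc m) (Suc i) x = x * Bernstein m i x + (1 - x) * Bernstein m (Suc i) x"
proof (cases "i < m")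
  case True
  then have "m - i = Suc (m - Suc i)" by simp
  then show ?thesis by (simp add: Bernstein_def algebra_simps)
next
  case False
  then show ?thesis by (simp add: Bernstein_def binomial_eq_0)
qed

text \<open>Pascal's rule for binomial coefficients, in the form that makes the derivative accessible by
  induction on the degree.\<close>

lemma bezier_curve_de_Casteljau:
  "bezier_curve (Suc m) c x = (1 - x) * bezier_curve m c x + x * bezier_curve m (\<lambda>i. c (Suc i)) x"
proof -
  \<comment> \<open>The basis function with index \<open>m + 1\<close> in degree \<open>m\<close> is zero, so a summand may be added.\<close>
  have "bezier_curve m c x = (\<Sum>i\<le>Suc m. c i * Bernstein m i x)"
    by (simp add: bezier_curve_def Bernstein_def)
  also have "\<dots> = c 0 * Bernstein m 0 x + (\<Sum>i\<le>m. c (Suc i) * Bernstein m (Suc i) x)"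
    by (rule sum.atMost_Suc_shift)
  finally have 1: "bezier_curve m c x =
      c 0 * Bernstein m 0 x + (\<Sum>i\<le>m. c (Suc i) * Bernstein m (Suc i) x)" .
  have "bezier_curve (Suc m) c x =
      c 0 * Bernstein (Suc m) 0 x + (\<Sum>i\<le>m. c (Suc i) * Bernstein (Suc m) (Suc i) x)"
    unfolding bezier_curve_def by (rule sum.atMost_Suc_shift)
  then show ?thesis
    unfolding 1 Bernstein_Suc_0 Bernstein_Suc_Suc
    by (simp add: bezier_curve_def algebra_simps sum.distrib sum_distrib_left sum_subtractf)
qed

lemma bezier_curve_diff:
  "bezier_curve m (\<lambda>i. c i - d i) x = bezier_curve m c x - bezier_curve m d x"
  by (simp add: bezier_curve_def algebra_simps sum_subtractf)

lemma bezier_curve_at_0 [simp]: "bezier_curve m c 0 = c 0"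
proof -
  have "bezier_curve m c 0 = (\<Sum>i\<le>m. if i = 0 then c 0 else 0)"
    unfolding bezier_curve_def by (rule sum.cong) (auto simp: Bernstein_def)
  then show ?thesis by simp
qed

text \<open>The hodograph: differentiating the de Casteljau recursion gives one copy of the curve with
  differenced coefficients from the weights \<open>1 - x\<close> and \<open>x\<close>, and \<open>m\<close> further copies from the
  induction hypothesis, recombined by the same recursion.\<close>

lemma bezier_curve_has_derivative:
  "(bezier_curve m c has_real_derivative
      real m * bezier_curve (m - 1) (\<lambda>i. c (Suc i) - c i) x) (at x)"
proof (induction m arbitrary: c)
  case 0
  have "bezier_curve 0 c = (\<lambda>x. c 0)"
    by (simp add: fun_eq_iff bezier_curve_def Bernstein_def)
  then show ?case by simp
next
  case (Suc m)
  have "bezier_curve (Suc m) c =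
      (\<lambda>x. (1 - x) * bezier_curve m c x + x * bezier_curve m (\<lambda>i. c (Suc i)) x)"
    by (simp add: fun_eq_iff bezier_curve_de_Casteljau)
  \<comment> \<open>For \<open>m = 0\<close>, where \<open>m - 1\<close> is truncated, both sides vanish.\<close>
  moreover have "real m * bezier_curve m (\<lambda>i. c (Suc i) - c i) x =
      (1 - x) * (real m * bezier_curve (m - 1) (\<lambda>i. c (Suc i) - c i) x)
      + x * (real m * bezier_curve (m - 1) (\<lambda>i. c (Suc (Suc i)) - c (Suc i)) x)"
    by (cases m) (simp_all add: bezier_curve_de_Casteljau algebra_simps)
  ultimately show ?case
    by (auto intro!: derivative_eq_intros Suc.IH simp: bezier_curve_diff algebra_simps)
qed

lemma bezier_curve_has_derivative_0:
  "(bezier_curve m c has_real_derivative real m * (c 1 - c 0)) (at 0)"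
  using bezier_curve_has_derivative[of m c 0] by simp

text \<open>A tensor-product polynomial is a Bezier curve of Bezier curves, so that both partial
  derivatives come from the univariate case.\<close>

lemma bezier_poly_eq_curve:
  "bezier_poly n c u v = bezier_curve n (\<lambda>i. bezier_curve n (c i) v) u"
  by (simp add: bezier_poly_def bezier_curve_def sum_distrib_left sum_distrib_right mult_ac)

lemma has_vector_derivative_vector_3:
  assumes "(f has_real_derivative f') (at x)" "(g has_real_derivative g') (at x)"
    and "(h has_real_derivative h') (at x)"
  shows "((\<lambda>x. vector [f x, g x, h x] :: real^3) has_vector_derivative vector [f', g', h']) (at x)"
proof -
  have eq: "vector [a, b, c] = a *\<^sub>R axis 1 1 + b *\<^sub>R axis 2 1 + c *\<^sub>R (axis 3 1 :: real^3)" for a b c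
    by (simp add: Finite_Cartesian_Product.vec_eq_iff forall_3 axis_def)
  show ?thesis unfolding eq
    by (intro has_vector_derivative_add has_vector_derivative_scaleR[OF _ has_vector_derivative_const, simplified]
        assms)
qed

lemma patch_derivative_u:
  "((\<lambda>u. patch n Z A B C D u 0) has_vector_derivative
     vector [(B - A) $ 1, (B - A) $ 2,
       real n * bezier_curve (n - 1) (\<lambda>i. Z A B C D (Suc i) 0 - Z A B C D i 0) u]) (at u)"
  unfolding patch_def bilinear_map_def bezier_poly_eq_curve
  by (intro has_vector_derivative_vector_3)
     (auto intro!: derivative_eq_intros bezier_curve_has_derivative[simplified] simp: algebra_simps)

lemma patch_derivative_v:
  "((\<lambda>v. patch n Z A B C D u v) has_vector_derivative
     vector [(1 - u) * (D - A) $ 1 + u * (C - B) $ 1, (1 - u) * (D - A) $ 2 + u * (C - B) $ 2,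
       bezier_curve n (\<lambda>i. real n * (Z A B C D i 1 - Z A B C D i 0)) u]) (at 0)"
proof -
  have "((\<lambda>v. bezier_curve n (\<lambda>i. bezier_curve n (Z A B C D i) v) u) has_real_derivative
      bezier_curve n (\<lambda>i. real n * (Z A B C D i 1 - Z A B C D i 0)) u) (at 0)"
    unfolding bezier_curve_def[of n _ u]
    by (intro DERIV_sum DERIV_cmult_right bezier_curve_has_derivative_0)
  then show ?thesis
    unfolding patch_def bilinear_map_def bezier_poly_eq_curve
    by (intro has_vector_derivative_vector_3)
       (auto intro!: derivative_eq_intros simp: algebra_simps)
qed

lemma patch_derivative_uv:
  "((\<lambda>u. vector_derivative (\<lambda>v. patch n Z A B C D u v) (at 0)) has_vector_derivative
     vector [(A - B + C - D) $ 1, (A - B + C - D) $ 2,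
       (real n)\<^sup>2 * (Z A B C D 1 1 - Z A B C D 1 0 - Z A B C D 0 1 + Z A B C D 0 0)]) (at 0)"
proof -
  have *: "(bezier_curve n (\<lambda>i. real n * (Z A B C D i 1 - Z A B C D i 0)) has_real_derivative
     (real n)\<^sup>2 * (Z A B C D 1 1 - Z A B C D 1 0 - Z A B C D 0 1 + Z A B C D 0 0)) (at 0)"
    using bezier_curve_has_derivative_0[of n "\<lambda>i. real n * (Z A B C D i 1 - Z A B C D i 0)"]
    by (simp add: algebra_simps power2_eq_square)
  show ?thesis
    unfolding vector_derivative_at[OF patch_derivative_v]
    by (intro has_vector_derivative_vector_3 *)
       (auto intro!: derivative_eq_intros simp: algebra_simps)
qed

lemma patch_derivative_uu:
  assumes "n \<ge> 1"
  shows "((\<lambda>u. vector_derivative (\<lambda>u. patch n Z A B C D u 0) (at u)) has_vector_derivative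
     vector [0, 0, real n * (real n - 1) * (Z A B C D 2 0 - 2 * Z A B C D 1 0 + Z A B C D 0 0)]) (at 0)"
proof -
  have *: "((\<lambda>u. real n * bezier_curve (n - 1) (\<lambda>i. Z A B C D (Suc i) 0 - Z A B C D i 0) u)
      has_real_derivative
      real n * (real n - 1) * (Z A B C D 2 0 - 2 * Z A B C D 1 0 + Z A B C D 0 0)) (at 0)"
    using DERIV_cmult[OF bezier_curve_has_derivative_0[of "n - 1" "\<lambda>i. Z A B C D (Suc i) 0 - Z A B C D i 0"], of "real n"] assms
    by (simp add: algebra_simps of_nat_diff numeral_2_eq_2)
  show ?thesis
    unfolding vector_derivative_at[OF patch_derivative_u]
    by (intro has_vector_derivative_vector_3 *) auto
qed

section \<open>The equation along one edge\<close>

text \<open>In the plane, any three vectors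
  \<open>a\<close>, \<open>b\<close>, \<open>c\<close> satisfy \<open>cr b c *\<^sub>R a - cr a c *\<^sub>R b + cr a b *\<^sub>R c = 0\<close>, to which \<open>cr q\<close> is applied.\<close>

lemma cr_Pluecker: "cr q a * cr b c - cr q b * cr a c + cr q c * cr a b = 0"
  by (simp add: cr_def algebra_simps)

text \<open>Here \<open>ab\<close>, \<open>pb\<close> and so on stand for cross products of the edge vectors \<open>a\<close>, \<open>b\<close>, \<open>c\<close> at a
  vertex, taken counter-clockwise, and of the planar mixed derivatives \<open>p\<close> (between \<open>a\<close> and \<open>b\<close>)
  and \<open>q\<close> (between \<open>b\<close> and \<open>c\<close>); capital letters are the heights belonging to these vectors. The
  two quotients are the twists. Multiplied by \<open>ab * bc\<close> each of them still has a denominator, which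
  cancels because the tangents are coplanar: \<open>C\<close> is eliminated from the twist of \<open>q\<close>, and \<open>A\<close>
  from that of \<open>p\<close>.\<close>

lemma twist_identity:
  fixes ab bc ac :: real
  assumes "ab \<noteq> 0" "bc \<noteq> 0"
    and eq0: "ac * B = ab * C + bc * A"
    and q: "qa * bc - qb * ac + qc * ab = 0"
    and p: "pa * bc - pb * ac + pc * ab = 0"
  shows "ab * bc * ((Tp * ab - A * pb + B * pa) / ab\<^sup>2 + (Tq * bc - B * qc + C * qb) / bc\<^sup>2
           - ac / (ab * bc) * \<delta>)
         = ab * Tq + bc * Tp + pb * C - qb * A - ac * \<delta> + (qa - pc) * B"
proof -
  have 1: "ab * ((Tq * bc - B * qc + C * qb) / bc) = ab * Tq - qb * A + qa * B"
  proof -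
    have "ab * (Tq * bc - B * qc + C * qb) = bc * (ab * Tq - qb * A + qa * B)
        + qb * (ab * C + bc * A - ac * B) - B * (qa * bc - qb * ac + qc * ab)"
      by (simp add: algebra_simps)
    also have "\<dots> = bc * (ab * Tq - qb * A + qa * B)"
      using eq0 q by simp
    finally have "ab * (Tq * bc - B * qc + C * qb) = bc * (ab * Tq - qb * A + qa * B)" .
    then show ?thesis using assms(2) by (simp add: field_simps)
  qed
  have 2: "bc * ((Tp * ab - A * pb + B * pa) / ab) = bc * Tp + pb * C - pc * B"
  proof -
    have "bc * (Tp * ab - A * pb + B * pa) = ab * (bc * Tp + pb * C - pc * B)
        - pb * (ab * C + bc * A - ac * B) + B * (pa * bc - pb * ac + pc * ab)"
      by (simp add: algebra_simps)
    also have "\<dots> = ab * (bc * Tp + pb * C - pc * B)"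
      using eq0 p by simp
    finally have "bc * (Tp * ab - A * pb + B * pa) = ab * (bc * Tp + pb * C - pc * B)" .
    then show ?thesis using assms(1) by (simp add: field_simps)
  qed
  have "ab * bc * ((Tp * ab - A * pb + B * pa) / ab\<^sup>2 + (Tq * bc - B * qc + C * qb) / bc\<^sup>2
           - ac / (ab * bc) * \<delta>) = bc * ((Tp * ab - A * pb + B * pa) / ab)
           + ab * ((Tq * bc - B * qc + C * qb) / bc) - ac * \<delta>"
    using assms(1,2) by (simp add: field_simps power2_eq_square)
  then show ?thesis unfolding 1 2 by (simp add: algebra_simps)
qed

text \<open>The coefficients \<open>z0\<close>, \<open>z1\<close>, \<open>z2\<close> lie on the edge, \<open>l0\<close>, \<open>l1\<close> in the row to its left and
  \<open>r0\<close>, \<open>r1\<close> in the row to its right. The left side of Eq(1) is multiplied by \<open>n\<close> in order to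
  express it by the derivatives \<open>A\<close>, \<open>B\<close>, \<open>C\<close>, \<open>Tp\<close>, \<open>Tq\<close> and \<open>\<delta>\<close> at the vertex. Eq(0) is used
  twice: as coplanarity of the tangents, and to remove a multiple of it that Eq(1) contains.\<close>

lemma eq_one_iff_twist_scalars:
  fixes ab bc ac n z0 z1 z2 l0 l1 r0 r1 :: real
  assumes "ab \<noteq> 0" "bc \<noteq> 0" "n \<noteq> 0"
    and eq0: "ab * (z0 - l0) + - bc * (r0 - z0) + ac * (z1 - z0) = 0" (is "?e0 = 0")
    and q: "qa * bc - qb * ac + qc * ab = 0"
    and p: "pa * bc - pb * ac + pc * ab = 0"
  defines "A \<equiv> n * (r0 - z0)" and "B \<equiv> n * (z1 - z0)" and "C \<equiv> n * (l0 - z0)"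
    and "Tp \<equiv> n\<^sup>2 * (r1 - r0 - z1 + z0)" and "Tq \<equiv> n\<^sup>2 * (l1 - z1 - l0 + z0)"
    and "\<delta> \<equiv> n * (n - 1) * (z2 - 2 * z1 + z0)"
  shows "n * (ab * (z1 - l1) + - bc * (r1 - z1))
           + ((ab + pb) * (z0 - l0) + (qb - bc) * (r0 - z0))
           + (n - 1) * ac * (z2 - z1) + (2 * ac - qa + pc) * (z1 - z0) = 0
         \<longleftrightarrow> (Tq * bc - B * qc + C * qb) / bc\<^sup>2 + (Tp * ab - A * pb + B * pa) / ab\<^sup>2
             = ac / (ab * bc) * \<delta>" (is "?E = 0 \<longleftrightarrow> ?q + ?p = ?d")
proof -
  have plane: "ac * B = ab * C + bc * A"
  proof -
    have "ac * B - (ab * C + bc * A) = n * ?e0"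
      by (simp add: A_def B_def C_def algebra_simps)
    then show ?thesis using eq0 by simp
  qed
  have "n * ?E = - (ab * Tq + bc * Tp + pb * C - qb * A - ac * \<delta> + (qa - pc) * B)
      + (n\<^sup>2 + n) * ?e0"
    by (simp add: A_def B_def C_def Tp_def Tq_def \<delta>_def power2_eq_square algebra_simps)
  also have "\<dots> = - (ab * bc * (?p + ?q - ?d))"
    using twist_identity[OF assms(1,2) plane q p] eq0 by simp
  finally have "?E = 0 \<longleftrightarrow> ?p + ?q - ?d = 0"
    using assms(1-3) by (metis mult_eq_0_iff neg_equal_0_iff_equal)
  then show ?thesis by (simp add: add.commute)
qed

lemma eps_eq:
  "eps n Z V vs W j = vector [(vs j - V) $ 1, (vs j - V) $ 2,
     real n * (Z V (vs j) (W j) (vs (j + 1)) 1 0 - Z V (vs j) (W j) (vs (j + 1)) 0 0)]"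
  unfolding eps_def star_patch_def by (simp add: vector_derivative_at[OF patch_derivative_u])

lemma tau_eq:
  fixes Z V vs W j
  defines "c \<equiv> Z V (vs j) (W j) (vs (j + 1))"
  shows "tau n Z V vs W j =
     vector [(V - vs j + W j - vs (j + 1)) $ 1, (V - vs j + W j - vs (j + 1)) $ 2,
             (real n)\<^sup>2 * (c 1 1 - c 1 0 - c 0 1 + c 0 0)]"
  unfolding tau_def star_patch_def c_def by (rule vector_derivative_at[OF patch_derivative_uv])

lemma delta_eq:
  fixes Z V vs W j
  assumes "n \<ge> 1"
  defines "c \<equiv> Z V (vs j) (W j) (vs (j + 1))"
  shows "delta n Z V vs W j = real n * (real n - 1) * (c 2 0 - 2 * c 1 0 + c 0 0)"
  unfolding delta_def star_patch_def c_def
  by (simp add: vector_derivative_at[OF patch_derivative_uu[OF assms(1)]])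

lemma det_cr:
  "Determinants.det (vector [vector [q $ 1, q $ 2, T], vector [b $ 1, b $ 2, B],
       vector [c $ 1, c $ 2, C]] :: real^3^3) = T * cr b c - B * cr q c + C * cr q b"
  by (simp add: det_3 cr_def algebra_simps)

text \<open>Both nets are read from \<open>V\<close> along the edge to \<open>vs (j + 1)\<close>, which is the \<open>v\<close>-direction of
  element \<open>j\<close> and the \<open>u\<close>-direction of element \<open>j + 1\<close>.\<close>

lemma bezier_net_common_edge:
  assumes "bezier_net T n Z" "ccw_star T V N vs W" "k \<le> n"
  shows "Z V (vs j) (W j) (vs (j + 1)) 0 k = Z V (vs (j + 1)) (W (j + 1)) (vs (j + 1 + 1)) k 0"
  using assms unfolding bezier_net_def ccw_star_def by metis

lemma ccw_star_cr_pos: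
  assumes "ccw_star T V N vs W"
  shows "cr (vs j - V) (vs (j + 1) - V) > 0"
proof -
  have "cr (V - vs (j + 1)) (vs j - V) > 0"
    using assms unfolding ccw_star_def mesh_element_def quad_vertices_def strictly_convex_quad_def
    by blast
  then show ?thesis by (simp add: cr_def algebra_simps)
qed

text \<open>With a single edge the element at \<open>V\<close> would be bounded by twice the same edge, contrary to
  the positive angle. For \<open>N = 1\<close> the two ones in a row of the circulant matrix would fall
  on the same column.\<close>

lemma ccw_star_ge_2:
  assumes "ccw_star T V N vs W"
  shows "N \<ge> 2"
proof -
  have "vs 1 \<in> neighbours T V"
    using assms unfolding ccw_star_def mesh_element_def neighbours_def quad_edge_def by blast
  then have "N \<noteq> 0"
    using assms by (auto simp: ccw_star_def bij_betw_def)
  moreover have "N \<noteq> 1"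
  proof
    assume "N = 1"
    then have "vs (0 + 1) = vs 0"
      using assms unfolding ccw_star_def by (metis of_nat_1)
    then show False
      using ccw_star_cr_pos[OF assms, of 0] by (simp add: cr_def)
  qed
  ultimately show ?thesis by simp
qed

text \<open>The heights of the tangents in \<open>tw j\<close> and \<open>tw (j - 1)\<close> come from the elements \<open>j - 1\<close>, \<open>j\<close>
  and \<open>j + 1\<close>, each read in its own \<open>u\<close>-direction. Since the nets agree along common edges, all of
  them are expressed by the nets \<open>k'\<close> and \<open>k\<close> of the two elements at the edge, which are also the
  ones in Eq(1).\<close>

lemma eq_one_at_iff_twist:
  assumes "n \<ge> 1" and net: "bezier_net T n Z" and star: "ccw_star T V N vs W"
    and eq0: "eq_zero_at Z V vs W j"
  shows "eq_one_at n Z V vs W j \<longleftrightarrow>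
    tw n Z V vs W j + tw n Z V vs W (j - 1) = edge_coeff V vs j * delta n Z V vs W j"
proof -
  define a b c where "a = vs (j - 1) - V" and "b = vs j - V" and "c = vs (j + 1) - V"
  define p q where "p = V - vs (j - 1) + W (j - 1) - vs j" and "q = V - vs j + W j - vs (j + 1)"
  define k k' where "k = Z V (vs j) (W j) (vs (j + 1))" and "k' = Z V (vs (j - 1)) (W (j - 1)) (vs j)"
  have k': "k' 0 0 = k 0 0" "k' 0 1 = k 1 0"
    using bezier_net_common_edge[OF net star, of _ "j - 1"] assms(1) by (simp_all add: k_def k'_def)
  have k'': "Z V (vs (j + 1)) (W (j + 1)) (vs (j + 1 + 1)) 0 0 = k 0 0"
    "Z V (vs (j + 1)) (W (j + 1)) (vs (j + 1 + 1)) 1 0 = k 0 1"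
    using bezier_net_common_edge[OF net star, of _ j] assms(1) by (simp_all add: k_def)
  have pos: "cr a b \<noteq> 0" "cr b c \<noteq> 0"
    using ccw_star_cr_pos[OF star, of "j - 1"] ccw_star_cr_pos[OF star, of j]
    by (simp_all add: a_def b_def c_def)
  have eps: "eps n Z V vs W (j - 1) = vector [a $ 1, a $ 2, real n * (k' 1 0 - k 0 0)]"
    "eps n Z V vs W j = vector [b $ 1, b $ 2, real n * (k 1 0 - k 0 0)]"
    "eps n Z V vs W (j + 1) = vector [c $ 1, c $ 2, real n * (k 0 1 - k 0 0)]"
    unfolding eps_eq k''
    using k'(1) by (simp_all add: a_def b_def c_def k_def k'_def)
  have tau: "tau n Z V vs W (j - 1) =
      vector [p $ 1, p $ 2, (real n)\<^sup>2 * (k' 1 1 - k' 1 0 - k 1 0 + k 0 0)]"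
    "tau n Z V vs W j = vector [q $ 1, q $ 2, (real n)\<^sup>2 * (k 1 1 - k 1 0 - k 0 1 + k 0 0)]"
    using k' by (simp_all add: tau_eq p_def q_def k_def k'_def)
  have tw: "tw n Z V vs W j = ((real n)\<^sup>2 * (k 1 1 - k 1 0 - k 0 1 + k 0 0) * cr b c
        - real n * (k 1 0 - k 0 0) * cr q c + real n * (k 0 1 - k 0 0) * cr q b) / (cr b c)\<^sup>2"
    "tw n Z V vs W (j - 1) = ((real n)\<^sup>2 * (k' 1 1 - k' 1 0 - k 1 0 + k 0 0) * cr a b
        - real n * (k' 1 0 - k 0 0) * cr p b + real n * (k 1 0 - k 0 0) * cr p a) / (cr a b)\<^sup>2"
    unfolding tw_def diff_add_cancel eps tau det_cr by (simp_all add: a_def b_def c_def)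
  have rhs: "edge_coeff V vs j = cr a c / (cr a b * cr b c)"
    "delta n Z V vs W j = real n * (real n - 1) * (k 2 0 - 2 * k 1 0 + k 0 0)"
    using assms(1) by (simp_all add: edge_coeff_def a_def b_def c_def delta_eq k_def)
  have e0: "cr a b * (k 0 0 - k 0 1) + - cr b c * (k' 1 0 - k 0 0) + cr a c * (k 1 0 - k 0 0) = 0"
    using eq0 by (simp add: eq_zero_at_def eq_zero_def row_C_def row_L_def row_R_def
        a_def b_def c_def k_def k'_def)
  have l1: "cr (V - vs j) (W (j - 1) - vs j) = cr a b + cr p b"
    and r1: "- cr (W j - vs j) (V - vs j) = cr q b - cr b c"
    and c1: "cr (vs (j - 1) - V) (W j - vs j) - cr (vs (j + 1) - V) (W (j - 1) - vs j)
        = 2 * cr a c - cr q a + cr p c"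
    by (simp_all add: cr_def a_def b_def c_def p_def q_def algebra_simps)
  have half: "2 * (x / 2) = x" for x :: real by simp
  have "eq_one_at n Z V vs W j \<longleftrightarrow>
      real n * (cr a b * (k 1 0 - k 1 1) + - cr b c * (k' 1 1 - k 1 0))
      + ((cr a b + cr p b) * (k 0 0 - k 0 1) + (cr q b - cr b c) * (k' 1 0 - k 0 0))
      + (real n - 1) * cr a c * (k 2 0 - k 1 0) + (2 * cr a c - cr q a + cr p c) * (k 1 0 - k 0 0) = 0"
    unfolding eq_one_at_def eq_one_def Let_def row_C_def row_L_def row_R_def half l1 r1 c1
    by (simp add: a_def b_def c_def k_def k'_def numeral_2_eq_2)
  also have "\<dots> \<longleftrightarrow>
      tw n Z V vs W j + tw n Z V vs W (j - 1) = edge_coeff V vs j * delta n Z V vs W j"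
    unfolding tw rhs using assms(1)
    by (intro eq_one_iff_twist_scalars pos e0 cr_Pluecker) simp
  finally show ?thesis .
qed

section \<open>Rank and range of the circulant matrix\<close>

lemma circ_matrix_carrier [simp]: "circ_matrix N \<in> carrier_mat N N"
  by (simp add: circ_matrix_def)

lemma circ_matrix_mult_index:
  assumes "N \<ge> 2" "i < N" "x \<in> carrier_vec N"
  shows "vec_index (circ_matrix N *\<^sub>v x) i = vec_index x i + vec_index x ((i + N - 1) mod N)"
proof -
  let ?p = "(i + N - 1) mod N"
  have "?p < N" using assms by simp
  have "?p \<noteq> i"
    using assms by (cases i) (auto simp: mod_if)
  have "vec_index (circ_matrix N *\<^sub>v x) i =
      (\<Sum>k\<in>{0..<N}. (if k = i \<or> k = ?p then 1 else 0) * vec_index x k)"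
    using assms by (simp add: circ_matrix_def scalar_prod_def)
  also have "\<dots> = (\<Sum>k\<in>{i, ?p}. vec_index x k)"
    using assms(2) \<open>?p < N\<close> by (intro sum.mono_neutral_cong_right) auto
  also have "\<dots> = vec_index x i + vec_index x ?p" using \<open>?p \<noteq> i\<close> by simp
  finally show ?thesis .
qed

lemma circ_matrix_mult_0:
  assumes "N \<ge> 2" "x \<in> carrier_vec N"
  shows "vec_index (circ_matrix N *\<^sub>v x) 0 = vec_index x 0 + vec_index x (N - 1)"
  using circ_matrix_mult_index[of N 0 x] assms by simp

lemma circ_matrix_mult_Suc:
  assumes "N \<ge> 2" "Suc i < N" "x \<in> carrier_vec N"
  shows "vec_index (circ_matrix N *\<^sub>v x) (Suc i) = vec_index x (Suc i) + vec_index x i"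
  using circ_matrix_mult_index[of N "Suc i" x] assms by simp

text \<open>Cancelling the entry in the upper right corner leaves a lower triangular matrix \<open>B\<close> with unit
  diagonal. It has full rank and differs from the circulant matrix by a matrix \<open>E\<close> of rank at most
  one.\<close>

lemma circ_matrix_rank_ge:
  assumes "N \<ge> 2"
  shows "N \<le> vec_space.rank N (circ_matrix N) + 1"
proof -
  define B where "B = Matrix.mat N N (\<lambda>(i, k). if k = i \<or> i = Suc k then 1 else (0::real))"
  define E where "E = Matrix.mat N N (\<lambda>(i, k). (if i = 0 then 1 else 0) * (if k = N - 1 then - 1 else (0::real)))"
  have [simp]: "B \<in> carrier_mat N N" "E \<in> carrier_mat N N"
    by (simp_all add: B_def E_def)
  have "Determinant.det B = prod_list (diag_mat B)"
    by (rule det_lower_triangular[of N]) (auto simp: B_def)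
  also have "\<dots> = 1"
    by (simp add: prod_list_diag_prod B_def)
  finally have "vec_space.rank N B = N"
    using vec_space.low_rank_det_zero[of B N] by simp
  moreover have "B = circ_matrix N + E"
    by (rule eq_matI)
       (use assms in \<open>auto simp: B_def E_def circ_matrix_def mod_if split: if_splits\<close>)
  moreover have "vec_space.rank N (circ_matrix N + E) \<le>
      vec_space.rank N (circ_matrix N) + vec_space.rank N E"
    by (rule vec_space.rank_subadditive[of _ _ N]) simp_all
  moreover have "vec_space.rank N E \<le> 1"
    by (rule vec_space.rank_le_1_product_entries[of _ _ N "\<lambda>i. if i = 0 then 1 else 0"
          "\<lambda>k. if k = N - 1 then - 1 else 0"]) (auto simp: E_def)
  ultimately show ?thesis by simp
qed

lemma circ_matrix_rank_odd:
  assumes "N \<ge> 2" "odd N"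
  shows "vec_space.rank N (circ_matrix N) = N"
proof -
  have "x = 0\<^sub>v N" if x: "x \<in> carrier_vec N" and zero: "circ_matrix N *\<^sub>v x = 0\<^sub>v N" for x
  proof -
    have alt: "vec_index x i = (-1) ^ i * vec_index x 0" if "i < N" for i
      using that
    proof (induction i)
      case (Suc i)
      have "vec_index x (Suc i) + vec_index x i = 0"
        using circ_matrix_mult_Suc[OF assms(1) Suc.prems x] Suc.prems by (simp add: zero)
      then show ?case using Suc by (simp add: eq_neg_iff_add_eq_0)
    qed simp
    have "vec_index x 0 + vec_index x (N - 1) = 0"
      using circ_matrix_mult_0[OF assms(1) x] assms by (simp add: zero)
    then have "vec_index x 0 = 0"
      using alt[of "N - 1"] assms by simp
    then show ?thesis
      using alt x by (intro eq_vecI) auto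
  qed
  then have "Determinant.det (circ_matrix N) \<noteq> 0"
    using det_0_iff_vec_prod_zero[OF circ_matrix_carrier] by blast
  then show ?thesis
    by (intro vec_space.low_rank_det_zero) simp_all
qed

lemma circ_matrix_rank_even:
  assumes "N \<ge> 2" "even N"
  shows "vec_space.rank N (circ_matrix N) = N - 1"
proof -
  define x :: "real Matrix.vec" where "x = Matrix.vec N (\<lambda>i. (-1) ^ i)"
  have x: "x \<in> carrier_vec N" by (simp add: x_def)
  have "vec_index (circ_matrix N *\<^sub>v x) i = 0" if "i < N" for i
  proof (cases i)
    case 0
    then show ?thesis
      using circ_matrix_mult_0[OF assms(1) x] assms by (simp add: x_def)
  next
    case (Suc k)
    then show ?thesis
      using circ_matrix_mult_Suc[OF assms(1) _ x, of k] that by (simp add: x_def)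
  qed
  then have "circ_matrix N *\<^sub>v x = 0\<^sub>v N"
    by (intro eq_vecI) (auto simp: circ_matrix_def)
  moreover have "vec_index x 0 \<noteq> vec_index (0\<^sub>v N) 0"
    using assms by (simp add: x_def)
  ultimately have "Determinant.det (circ_matrix N) = 0"
    using det_0_iff_vec_prod_zero[OF circ_matrix_carrier] x by metis
  then have "vec_space.rank N (circ_matrix N) < N"
    by (intro vec_space.det_zero_low_rank) simp_all
  then show ?thesis
    using circ_matrix_rank_ge[OF assms(1)] by simp
qed

lemma sum_alternating_telescope:
  fixes x :: "nat \<Rightarrow> real"
  shows "(\<Sum>i<m. (-1) ^ i * (x (Suc i) + x i)) = x 0 - (-1) ^ m * x m"
  by (induction m) (simp_all add: algebra_simps)

text \<open>The alternating sum over the rows vanishes identically in \<open>x\<close>, which gives necessity.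
  Conversely, forward substitution from \<open>x 0 = b 0\<close> solves all rows but the first, and its last entry
  is, up to sign, the alternating sum of \<open>b\<close>, so that the first row holds as well.\<close>

lemma circ_matrix_solvable_iff:
  assumes "N \<ge> 2" "even N" "b \<in> carrier_vec N"
  shows "(\<exists>x\<in>carrier_vec N. circ_matrix N *\<^sub>v x = b) \<longleftrightarrow> (\<Sum>i<N. (-1) ^ i * vec_index b i) = 0"
proof
  assume "\<exists>x\<in>carrier_vec N. circ_matrix N *\<^sub>v x = b"
  then obtain x where x: "x \<in> carrier_vec N" and b: "circ_matrix N *\<^sub>v x = b" by blast
  \<comment> \<open>Row 0 contributes the first and the last unknown; the other rows telescope to the same two.\<close>
  obtain m where m: "N = Suc m" "odd m" using assms by (cases N) auto
  have "(\<Sum>i<N. (-1) ^ i * vec_index b i) =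
      vec_index b 0 - (\<Sum>i<m. (-1) ^ i * vec_index b (Suc i))"
    unfolding m(1) sum.lessThan_Suc_shift by (simp add: sum_negf)
  also have "(\<Sum>i<m. (-1) ^ i * vec_index b (Suc i)) =
      (\<Sum>i<m. (-1) ^ i * (vec_index x (Suc i) + vec_index x i))"
    using circ_matrix_mult_Suc[OF assms(1) _ x] m(1) unfolding b by (intro sum.cong) auto
  also have "\<dots> = vec_index x 0 + vec_index x m"
    using m by (simp add: sum_alternating_telescope)
  also have "\<dots> = vec_index b 0"
    using circ_matrix_mult_0[OF assms(1) x] unfolding b by (simp add: m(1))
  finally show "(\<Sum>i<N. (-1) ^ i * vec_index b i) = 0" by simp
next
  assume sum: "(\<Sum>i<N. (-1) ^ i * vec_index b i) = 0"
  define f where "f i = (-1) ^ i * (\<Sum>k\<le>i. (-1) ^ k * vec_index b k)" for i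
  define x where "x = Matrix.vec N f"
  have x: "x \<in> carrier_vec N" by (simp add: x_def)
  have "f (N - 1) = 0"
    using sum assms(1) by (cases N) (simp_all add: f_def lessThan_Suc_atMost)
  have "vec_index (circ_matrix N *\<^sub>v x) i = vec_index b i" if "i < N" for i
  proof (cases i)
    case 0
    then show ?thesis
      using circ_matrix_mult_0[OF assms(1) x] assms \<open>f (N - 1) = 0\<close> by (simp add: x_def f_def)
  next
    case (Suc k)
    have "f (Suc k) + f k = vec_index b (Suc k)"
      by (simp add: f_def algebra_simps flip: power_add mult.assoc)
    then show ?thesis
      using circ_matrix_mult_Suc[OF assms(1) _ x, of k] that Suc by (simp add: x_def)
  qed
  then have "circ_matrix N *\<^sub>v x = b"
    using assms(3) by (intro eq_vecI) (auto simp: circ_matrix_def)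
  then show "\<exists>x\<in>carrier_vec N. circ_matrix N *\<^sub>v x = b" using x by blast
qed

section \<open>The system at an inner vertex\<close>

lemma tw_periodic:
  assumes "ccw_star T V N vs W"
  shows "tw n Z V vs W (j + int N) = tw n Z V vs W j"
proof -
  have "vs (j + int N + 1) = vs (j + 1)" "vs (j + int N + 1 + 1) = vs (j + 1 + 1)"
    "W (j + int N + 1) = W (j + 1)" "vs (j + int N) = vs j" "W (j + int N) = W j"
    using assms unfolding ccw_star_def by (metis add.commute add.left_commute)+
  then show ?thesis
    by (simp only: tw_def tau_def eps_def star_patch_def)
qed

lemma circ_matrix_tw_vec_index:
  assumes star: "ccw_star T V N vs W" and "i < N"
  shows "vec_index (circ_matrix N *\<^sub>v tw_vec N n Z V vs W) i =
    tw n Z V vs W (int i + 1) + tw n Z V vs W (int i)"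
proof (cases i)
  case 0
  then show ?thesis
    using circ_matrix_mult_0[OF ccw_star_ge_2[OF star], of "tw_vec N n Z V vs W"]
      tw_periodic[OF star, of n Z 0] assms(2)
    by (simp add: tw_vec_def of_nat_diff)
next
  case (Suc k)
  then show ?thesis
    using circ_matrix_mult_Suc[OF ccw_star_ge_2[OF star], of k "tw_vec N n Z V vs W"] assms(2)
    by (simp add: tw_vec_def add.commute)
qed

lemma circ_matrix_system_iff:
  assumes star: "ccw_star T V N vs W"
  shows "circ_matrix N *\<^sub>v tw_vec N n Z V vs W = rhs_vec N n Z V vs W \<longleftrightarrow>
    (\<forall>j\<in>{1..int N}. tw n Z V vs W j + tw n Z V vs W (j - 1)
        = edge_coeff V vs j * delta n Z V vs W j)" (is "_ \<longleftrightarrow> (\<forall>j\<in>_. ?P j)")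
proof -
  have "circ_matrix N *\<^sub>v tw_vec N n Z V vs W = rhs_vec N n Z V vs W \<longleftrightarrow>
      (\<forall>i<N. vec_index (circ_matrix N *\<^sub>v tw_vec N n Z V vs W) i
         = vec_index (rhs_vec N n Z V vs W) i)"
    by (simp add: Matrix.vec_eq_iff circ_matrix_def rhs_vec_def)
  also have "\<dots> \<longleftrightarrow> (\<forall>i<N. ?P (int i + 1))"
    using circ_matrix_tw_vec_index[OF star] by (simp add: rhs_vec_def)
  also have "\<dots> \<longleftrightarrow> (\<forall>j\<in>{1..int N}. ?P j)"
  proof (intro iffI ballI allI impI)
    fix j assume *: "\<forall>i<N. ?P (int i + 1)" and j: "j \<in> {1..int N}"
    then have "nat (j - 1) < N" "int (nat (j - 1)) = j - 1" by auto
    then show "?P j" using *[rule_format, of "nat (j - 1)"] by simp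
  next
    fix i assume *: "\<forall>j\<in>{1..int N}. ?P j" and "i < N"
    then show "?P (int i + 1)" using *[rule_format, of "int i + 1"] by simp
  qed
  finally show ?thesis .
qed

lemma circular_constraint_iff:
  "circular_constraint N n Z V vs W \<longleftrightarrow> (\<Sum>i<N. (-1) ^ i * vec_index (rhs_vec N n Z V vs W) i) = 0"
proof -
  have "(\<Sum>j = 1..N. (-1) ^ j * (edge_coeff V vs (int j) * delta n Z V vs W (int j))) =
      - (\<Sum>i<N. (-1) ^ i * vec_index (rhs_vec N n Z V vs W) i)"
    unfolding One_nat_def sum.atLeast1_atMost_eq
    by (simp add: rhs_vec_def sum_negf add.commute)
  then show ?thesis by (simp add: circular_constraint_def)
qed

theorem theorem4:
  fixes T :: "point set set" and Z :: net and V :: point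
    and n N :: nat and vs W :: "int \<Rightarrow> point"
  assumes "n \<ge> 4"
    and "quad_mesh T"
    and "bezier_net T n Z"
    and "inner_vertex T V"
    and "N = valence T V"
    and "ccw_star T V N vs W"
    and "\<forall>j\<in>{1..int N}. eq_zero_at Z V vs W j"
  shows "((\<forall>j\<in>{1..int N}. eq_one_at n Z V vs W j) \<longleftrightarrow>
            circ_matrix N *\<^sub>v tw_vec N n Z V vs W = rhs_vec N n Z V vs W) \<and>
         (odd N \<longrightarrow> vec_space.rank N (circ_matrix N) = N) \<and>
         (even N \<longrightarrow>
            vec_space.rank N (circ_matrix N) = N - 1 \<and>
            ((\<exists>x\<in>carrier_vec N. circ_matrix N *\<^sub>v x = rhs_vec N n Z V vs W) \<longleftrightarrow>
             circular_constraint N n Z V vs W))"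
proof -
  note star = \<open>ccw_star T V N vs W\<close>
  have "eq_one_at n Z V vs W j \<longleftrightarrow>
      tw n Z V vs W j + tw n Z V vs W (j - 1) = edge_coeff V vs j * delta n Z V vs W j"
    if "j \<in> {1..int N}" for j
    using eq_one_at_iff_twist[OF _ \<open>bezier_net T n Z\<close> star] assms(1,7) that by simp
  then have "(\<forall>j\<in>{1..int N}. eq_one_at n Z V vs W j) \<longleftrightarrow>
      circ_matrix N *\<^sub>v tw_vec N n Z V vs W = rhs_vec N n Z V vs W"
    unfolding circ_matrix_system_iff[OF star] by simp
  moreover have "rhs_vec N n Z V vs W \<in> carrier_vec N"
    by (simp add: rhs_vec_def)
  ultimately show ?thesis
    using circ_matrix_rank_odd circ_matrix_rank_even circ_matrix_solvable_iff
      circular_constraint_iff ccw_star_ge_2[OF star] by blast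
qed

end
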